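(* Let $\mathcal{A}\subseteq\mathbb{R}^d$ be a nonempty finite set and let $f:\mathbb{R}^d\to\mathbb{R}$ be such that: (i) $-\infty<f_{\min}:=\min_{a\in\mathcal{A}}f(a)$; (ii) $f$ is differentiable and its gradient is $L_f$-Lipschitz on $\mathbb{R}^d$; (iii) for some constant $\mu\ge 0$, the function $x\mapsto f(x)+\frac{\mu}{2}\|x\|^2$ is convex. Let $\sigma(\rho):=\rho-\mu$ and let $\rho,\gamma>0$ satisfy $$\frac{2L_f^2+8(\rho+L_f)^2\gamma^2}{\rho}+\frac{\gamma^2(\rho+L_f)-(1-\gamma)^2\sigma(\rho)}{2}<0.$$ Let $(x^r,y^r,\lambda^r)_{r\ge0}$ be generated by the I-ADMM-Q algorithm with parameters $\rho,\gamma$, and assume that these iterates are bounded. Then for any limit point $(\bar x,\bar y,\bar\lambda)$ of the iterates, $\bar x$ is a $\rho$-stationary point of the problem $\min_{x\in\mathcal{A}}f(x)$.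
   Context: Norms are Euclidean. For a nonempty finite set $\mathcal{A}$, the projection $\mathcal{P}_{\mathcal{A}}(x)$ is an element of $\arg\min_{a\in\mathcal{A}}\|x-a\|^2$; if this set has several elements, the lexicographically smallest one is chosen. Let $\mathcal{I}_{\mathcal{A}}(y)=0$ if $y\in\mathcal{A}$ and $+\infty$ otherwise. The augmented Lagrangian is $\mathcal{L}(x,y,\lambda)=f(x)+\mathcal{I}_{\mathcal{A}}(y)+\langle\lambda,x-y\rangle+\frac{\rho}{2}\|x-y\|^2$. I-ADMM-Q algorithm (parameters $\rho,\gamma>0$): start from $x^0=y^0\in\mathcal{A}$ and arbitrary $\lambda^0\in\mathbb{R}^d$; for $r=0,1,2,\dots$: set $y^{r+1}=\mathcal{P}_{\mathcal{A}}(x^r+\rho^{-1}\lambda^r)$; let $x_\star^{r+1}=\arg\min_x\mathcal{L}(x,y^{r+1},\lambda^r)$ and choose any point $x^{r+1}$ satisfying $\|x^{r+1}-x_\star^{r+1}\|\le\gamma\min\{\|x^{r+1}-y^{r+1}\|,\|x^{r+1}-x^r\|\}$; set $\lambda^{r+1}=\lambda^r+\rho(x^{r+1}-y^{r+1})$. A point $\bar x$ is a $\rho$-stationary point of $\min_{x\in\mathcal{A}}f(x)$ if $\bar x\in\arg\min_{a\in\mathcal{A}}\|a-(\bar x-\rho^{-1}\nabla f(\bar x))\|$. *)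

theory Defs
  imports "HOL-Analysis.Analysis" "HOL-Library.Fun_Lexorder"
begin

text \<open>Vectors of dimension \<open>d\<close> are elements of \<^typ>\<open>real ^ 'n\<close> with \<open>d = CARD('n)\<close>; the
  linear order on the index type is what makes the lexicographic order meaningful.\<close>

definition gradient :: "('a::real_inner \<Rightarrow> real) \<Rightarrow> 'a \<Rightarrow> 'a" where
  "gradient f x = (THE D. GDERIV f x :> D)"

definition projection ::
  "(real ^ 'n::{finite,linorder}) set \<Rightarrow> real ^ 'n::{finite,linorder} \<Rightarrow> real ^ 'n::{finite,linorder}" where
  "projection A x =
     (THE a. is_arg_min (\<lambda>a. (norm (x - a))\<^sup>2) (\<lambda>a. a \<in> A) a \<and>
             (\<forall>b. is_arg_min (\<lambda>a. (norm (x - a))\<^sup>2) (\<lambda>a. a \<in> A) b \<longrightarrow>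
                  b = a \<or> less_fun (($) a) (($) b)))"

definition indicator_inf :: "'a set \<Rightarrow> 'a \<Rightarrow> ereal" where
  "indicator_inf A y = (if y \<in> A then 0 else \<infinity>)"

definition aug_lagrangian ::
  "('a::real_inner \<Rightarrow> real) \<Rightarrow> 'a set \<Rightarrow> real \<Rightarrow> 'a \<Rightarrow> 'a \<Rightarrow> 'a \<Rightarrow> ereal" where
  "aug_lagrangian f A \<rho> x y l =
     ereal (f x) + indicator_inf A y + ereal (l \<bullet> (x - y)) + ereal (\<rho> / 2 * (norm (x - y))\<^sup>2)"

text \<open>The inexact step allows an arbitrary choice of \<^term>\<open>x (Suc r)\<close>, so the algorithm is a
  relation that holds for every sequence it may generate.\<close>

definition I_ADMM_Q ::
  "(real ^ 'n::{finite,linorder} \<Rightarrow> real) \<Rightarrow> (real ^ 'n::{finite,linorder}) set \<Rightarrow> real \<Rightarrow> real \<Rightarrow>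
   (nat \<Rightarrow> real ^ 'n::{finite,linorder}) \<Rightarrow> (nat \<Rightarrow> real ^ 'n::{finite,linorder}) \<Rightarrow> (nat \<Rightarrow> real ^ 'n::{finite,linorder}) \<Rightarrow> bool" where
  "I_ADMM_Q f A \<rho> \<gamma> x y l \<longleftrightarrow>
     x 0 = y 0 \<and> y 0 \<in> A \<and>
     (\<forall>r. y (Suc r) = projection A (x r + (1 / \<rho>) *\<^sub>R l r) \<and>
          (\<exists>x_star. is_arg_min (\<lambda>z. aug_lagrangian f A \<rho> z (y (Suc r)) (l r)) (\<lambda>z. True) x_star \<and>
             norm (x (Suc r) - x_star)
               \<le> \<gamma> * min (norm (x (Suc r) - y (Suc r))) (norm (x (Suc r) - x r))) \<and>
          l (Suc r) = l r + \<rho> *\<^sub>R (x (Suc r) - y (Suc r)))"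

definition rho_stationary ::
  "('a::real_inner \<Rightarrow> real) \<Rightarrow> 'a set \<Rightarrow> real \<Rightarrow> 'a \<Rightarrow> bool" where
  "rho_stationary f A \<rho> xbar \<longleftrightarrow>
     is_arg_min (\<lambda>a. norm (a - (xbar - (1 / \<rho>) *\<^sub>R gradient f xbar))) (\<lambda>a. a \<in> A) xbar"

definition seq_limit_point :: "(nat \<Rightarrow> 'a::topological_space) \<Rightarrow> 'a \<Rightarrow> bool" where
  "seq_limit_point z w \<longleftrightarrow> (\<exists>s. strict_mono s \<and> (z \<circ> s) \<longlonglongrightarrow> w)"

lemma gradient_eqI:
  assumes "GDERIV f x :> D"
  shows "gradient f x = D"
  unfolding gradient_def
proof (rule the_equality)
  fix E assume "GDERIV f x :> E"
  then have "(\<lambda>h. inner h E) = (\<lambda>h. inner h D)"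
    using assms has_derivative_unique unfolding gderiv_def by blast
  then have "inner (E - D) (E - D) = 0"
    by (metis inner_diff_right right_minus_eq)
  then show "E = D" by simp
qed (fact assms)

lemma gderiv_gradient:
  fixes f :: "'a::euclidean_space \<Rightarrow> real"
  assumes "f differentiable at x"
  shows "GDERIV f x :> gradient f x"
proof -
  obtain f' where f': "(f has_derivative f') (at x)"
    using assms unfolding differentiable_def by blast
  then have lin: "linear f'" by (simp add: has_derivative_linear)
  let ?D = "adjoint f' 1"
  have "f' = (\<lambda>h. inner h ?D)"
    using adjoint_works[OF lin, of _ 1] by auto
  then have "GDERIV f x :> ?D" using f' unfolding gderiv_def by simp
  then show ?thesis using gradient_eqI by metis
qed

lemma projection_works:
  fixes A :: "(real ^ 'n::{finite,linorder}) set"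
  assumes "finite A" "A \<noteq> {}"
  shows "is_arg_min (\<lambda>a. (norm (x - a))\<^sup>2) (\<lambda>a. a \<in> A) (projection A x)"
    and "\<And>b. is_arg_min (\<lambda>a. (norm (x - a))\<^sup>2) (\<lambda>a. a \<in> A) b \<Longrightarrow>
           b = projection A x \<or> less_fun (($) (projection A x)) (($) b)"
proof -
  define S where "S = {a. is_arg_min (\<lambda>a. (norm (x - a))\<^sup>2) (\<lambda>a. a \<in> A) a}"
  define R where "R a b \<longleftrightarrow> less_fun (($) a) (($) b)" for a b :: "real ^ 'n::{finite,linorder}"
  have "finite S" using assms(1) by (rule rev_finite_subset) (auto simp: S_def is_arg_min_def)
  moreover have "S \<noteq> {}"
    using ex_is_arg_min_if_finite[OF assms, of "\<lambda>a. (norm (x - a))\<^sup>2"] by (auto simp: S_def)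
  moreover have "asymp_on S R" by (auto simp: R_def asymp_on_def dest: less_fun_asym)
  moreover have "transp_on S R" by (auto simp: R_def transp_on_def intro: less_fun_trans)
  ultimately obtain m where m: "m \<in> S" "\<And>b. b \<in> S \<Longrightarrow> b \<noteq> m \<Longrightarrow> \<not> R b m"
    using Finite_Set.bex_min_element[of S R] by blast
  have tot: "b = a \<or> R a b \<or> R b a" for a b
    using less_fun_trichotomy[of "($) a" "($) b"] by (auto simp: R_def vec_nth_inject)
  have "\<exists>!a. a \<in> S \<and> (\<forall>b. b \<in> S \<longrightarrow> b = a \<or> R a b)"
  proof (rule ex1I[of _ m])
    show "m \<in> S \<and> (\<forall>b. b \<in> S \<longrightarrow> b = m \<or> R m b)" using m tot by blast
    show "a = m" if "a \<in> S \<and> (\<forall>b. b \<in> S \<longrightarrow> b = a \<or> R a b)" for a using m that by blast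
  qed
  from theI'[OF this]
  have "projection A x \<in> S \<and> (\<forall>b. b \<in> S \<longrightarrow> b = projection A x \<or> R (projection A x) b)"
    unfolding projection_def S_def R_def by simp
  then show "is_arg_min (\<lambda>a. (norm (x - a))\<^sup>2) (\<lambda>a. a \<in> A) (projection A x)"
    and "\<And>b. is_arg_min (\<lambda>a. (norm (x - a))\<^sup>2) (\<lambda>a. a \<in> A) b \<Longrightarrow>
           b = projection A x \<or> less_fun (($) (projection A x)) (($) b)"
    by (auto simp: S_def R_def)
qed

end

theory Submission
  imports Defs
begin

text \<open>Up to an error controlled by the inexactness of the \<open>x\<close>-step, the multiplier \<open>\<lambda>\<^sup>r\<close> equals
  \<open>- \<nabla>f(x\<^sup>r)\<close>, so the increase of the augmented Lagrangian in the dual update is bounded by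
  \<open>\<parallel>x\<^sup>r\<^sup>+\<^sup>1 - x\<^sup>r\<parallel>\<^sup>2\<close> and \<open>\<parallel>x\<^sup>r - x\<^sup>r\<^sup>-\<^sup>1\<parallel>\<^sup>2\<close>. Strong convexity in \<open>x\<close> yields a decrease
  in the primal steps that outweighs it: adding a multiple of \<open>\<parallel>x\<^sup>r - x\<^sup>r\<^sup>-\<^sup>1\<parallel>\<^sup>2\<close> to the augmented
  Lagrangian gives a Lyapunov function. Boundedness of the iterates bounds it below, so successive
  differences of \<open>x\<close>, hence of \<open>\<lambda>\<close>, tend to zero. At a limit point this forces
  \<open>x = y\<close> and \<open>\<lambda> = - \<nabla>f(x)\<close>, and the minimality defining the projection passes to the limit.\<close>

section \<open>Smooth and strongly convex functions\<close>

text \<open>The descent lemma, obtained without integrating: along the ray from \<open>a\<close>,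
  the auxiliary \<open>h\<close> collects \<open>f\<close> minus its linear and quadratic bounds,
  and Cauchy-Schwarz with the Lipschitz bound makes its derivative nonpositive for
  \<open>t \<ge> 0\<close>.\<close>

lemma gderiv_lipschitz_upper_bound:
  fixes f :: "'a::real_inner \<Rightarrow> real"
  assumes grad: "\<And>z. GDERIV f z :> g z" and lip: "L-lipschitz_on UNIV g"
  shows "f (a + e) \<le> f a + g a \<bullet> e + L / 2 * (norm e)\<^sup>2"
proof -
  define h where "h t = f (a + t *\<^sub>R e) - t * (g a \<bullet> e) - L / 2 * t\<^sup>2 * (norm e)\<^sup>2" for t
  have deriv: "(h has_real_derivative (g (a + t *\<^sub>R e) \<bullet> e - g a \<bullet> e - L * t * (norm e)\<^sup>2)) (at t)" for t
  proof -
    have "((\<lambda>t. a + t *\<^sub>R e) has_derivative (\<lambda>t. t *\<^sub>R e)) (at t)"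
      by (auto intro!: derivative_eq_intros)
    moreover have "(f has_derivative (\<lambda>h. h \<bullet> g (a + t *\<^sub>R e))) (at (a + t *\<^sub>R e))"
      using grad unfolding gderiv_def .
    ultimately have "((\<lambda>t. f (a + t *\<^sub>R e)) has_derivative (\<lambda>s. (s *\<^sub>R e) \<bullet> g (a + t *\<^sub>R e))) (at t)"
      by (rule has_derivative_compose)
    then have "((\<lambda>t. f (a + t *\<^sub>R e)) has_real_derivative g (a + t *\<^sub>R e) \<bullet> e) (at t)"
      by (simp add: has_field_derivative_def inner_commute mult_commute_abs)
    then show ?thesis unfolding h_def by (auto intro!: derivative_eq_intros)
  qed
  have nonpos: "g (a + t *\<^sub>R e) \<bullet> e - g a \<bullet> e - L * t * (norm e)\<^sup>2 \<le> 0" if "0 \<le> t" for t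
  proof -
    have "(g (a + t *\<^sub>R e) - g a) \<bullet> e \<le> norm (g (a + t *\<^sub>R e) - g a) * norm e"
      by (rule norm_cauchy_schwarz)
    also have "\<dots> \<le> (L * (t * norm e)) * norm e"
      using lipschitz_onD[OF lip, of "a + t *\<^sub>R e" a] that
      by (intro mult_right_mono) (auto simp: dist_norm)
    finally show ?thesis by (simp add: inner_diff_left power2_eq_square algebra_simps)
  qed
  have "h 1 \<le> h 0"
    by (rule DERIV_nonpos_imp_nonincreasing[OF zero_le_one]) (use deriv nonpos in blast)
  then show ?thesis by (simp add: h_def)
qed

lemma gderiv_zero_at_min:
  fixes f :: "'a::real_inner \<Rightarrow> real"
  assumes "GDERIV f a :> D" and min: "\<And>z. f a \<le> f z"
  shows "D = 0"
proof -
  have "(f has_derivative (\<lambda>h. h \<bullet> D)) (at a)" using assms(1) unfolding gderiv_def .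
  then have "(\<lambda>h. h \<bullet> D) = (\<lambda>h. 0)" by (rule has_derivative_local_min) (simp add: min)
  then have "D \<bullet> D = 0" by meson
  then show ?thesis by simp
qed

lemma norm_convex_combination_squared:
  fixes a z :: "'a::real_inner"
  shows "(norm ((1 - t) *\<^sub>R a + t *\<^sub>R z))\<^sup>2
    = (1 - t) * (norm a)\<^sup>2 + t * (norm z)\<^sup>2 - t * (1 - t) * (norm (z - a))\<^sup>2"
  unfolding power2_norm_eq_inner
  by (simp only: inner_add_left inner_add_right inner_diff_left inner_diff_right
      inner_scaleR_left inner_scaleR_right inner_commute[of z a]) (simp add: algebra_simps)

lemma norm_add_scaled_squared:
  fixes e w :: "'a::real_inner"
  shows "(norm (e + (1 / \<rho>) *\<^sub>R w))\<^sup>2 = (norm e)\<^sup>2 + 2 / \<rho> * (w \<bullet> e) + (norm w)\<^sup>2 / \<rho>\<^sup>2"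
  unfolding power2_norm_eq_inner
  by (simp only: inner_add_left inner_add_right inner_scaleR_left inner_scaleR_right
      inner_commute[of e w]) (simp add: power2_eq_square divide_inverse algebra_simps)

text \<open>Compare the minimum with the value at a convex combination of \<open>a\<close> and
  \<open>z\<close> of weight \<open>t\<close>, divide by \<open>t\<close>, and let \<open>t\<close>
  tend to 0 from the right.\<close>

lemma strongly_convex_min_growth:
  fixes h :: "'a::real_inner \<Rightarrow> real"
  assumes cvx: "convex_on UNIV (\<lambda>z. h z - \<sigma> / 2 * (norm z)\<^sup>2)" and min: "\<And>z. h a \<le> h z"
  shows "h a + \<sigma> / 2 * (norm (z - a))\<^sup>2 \<le> h z"
proof -
  have *: "h a + \<sigma> / 2 * (1 - t) * (norm (z - a))\<^sup>2 \<le> h z" if t: "0 < t" "t < 1" for t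
  proof -
    have "h ((1 - t) *\<^sub>R a + t *\<^sub>R z) - \<sigma> / 2 * (norm ((1 - t) *\<^sub>R a + t *\<^sub>R z))\<^sup>2
        \<le> (1 - t) * (h a - \<sigma> / 2 * (norm a)\<^sup>2) + t * (h z - \<sigma> / 2 * (norm z)\<^sup>2)"
      using convex_onD[OF cvx, of t a z] t by simp
    then have "h a \<le> (1 - t) * h a + t * h z - \<sigma> / 2 * (t * (1 - t) * (norm (z - a))\<^sup>2)"
      using min[of "(1 - t) *\<^sub>R a + t *\<^sub>R z"]
      unfolding norm_convex_combination_squared by (simp add: field_simps)
    then have "t * (h a + \<sigma> / 2 * (1 - t) * (norm (z - a))\<^sup>2) \<le> t * h z"
      by (simp add: field_simps)
    then show ?thesis using t by simp
  qed
  have lim: "((\<lambda>t. h a + \<sigma> / 2 * (1 - t) * (norm (z - a))\<^sup>2)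
      \<longlongrightarrow> h a + \<sigma> / 2 * (1 - 0) * (norm (z - a))\<^sup>2) (at_right 0)"
    by (intro tendsto_intros)
  have "\<forall>\<^sub>F t in at_right 0. h a + \<sigma> / 2 * (1 - t) * (norm (z - a))\<^sup>2 \<le> h z"
    using eventually_at_right_real[OF zero_less_one] by eventually_elim (use * in auto)
  from tendsto_upperbound[OF lim this trivial_limit_at_right_real] show ?thesis by simp
qed

section \<open>Bounded runs of the inexact ADMM\<close>

text \<open>What the analysis takes from the algorithm: \<open>y\<close> minimises a distance over
  \<open>A\<close>, \<open>xs r\<close> is the exact minimiser of the \<open>x\<close>-subproblem,
  and the error is relative to the last \<open>x\<close>-step. \<open>lagr\<close> is the finite
  part of the augmented Lagrangian, with which it agrees when \<open>v\<close> lies in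
  \<open>A\<close>.\<close>

locale inexact_admm_run =
  fixes f :: "'a::euclidean_space \<Rightarrow> real" and g :: "'a \<Rightarrow> 'a" and A :: "'a set"
    and L \<mu> \<rho> \<gamma> :: real and x y l xs :: "nat \<Rightarrow> 'a"
  fixes lagr :: "'a \<Rightarrow> 'a \<Rightarrow> 'a \<Rightarrow> real"
  defines "lagr \<equiv> \<lambda>u v w. f u + w \<bullet> (u - v) + \<rho> / 2 * (norm (u - v))\<^sup>2"
  assumes grad: "GDERIV f z :> g z"
    and lip: "L-lipschitz_on UNIV g"
    and weakly_convex: "convex_on UNIV (\<lambda>z. f z + \<mu> / 2 * (norm z)\<^sup>2)"
    and \<mu>: "0 \<le> \<mu>" and \<rho>: "0 < \<rho>" and \<gamma>: "0 < \<gamma>"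
    and descent_condition: "(2 * L\<^sup>2 + 8 * (\<rho> + L)\<^sup>2 * \<gamma>\<^sup>2) / \<rho>
           + (\<gamma>\<^sup>2 * (\<rho> + L) - (1 - \<gamma>)\<^sup>2 * (\<rho> - \<mu>)) / 2 < 0"
    and y_in: "y r \<in> A"
    and y_min: "a \<in> A \<Longrightarrow>
      norm (x r + (1 / \<rho>) *\<^sub>R l r - y (Suc r)) \<le> norm (x r + (1 / \<rho>) *\<^sub>R l r - a)"
    and xs_min: "lagr (xs r) (y (Suc r)) (l r) \<le> lagr z (y (Suc r)) (l r)"
    and error: "norm (x (Suc r) - xs r) \<le> \<gamma> * norm (x (Suc r) - x r)"
    and l_Suc: "l (Suc r) = l r + \<rho> *\<^sub>R (x (Suc r) - y (Suc r))"
    and bounded_x: "bounded (range x)" and bounded_y: "bounded (range y)"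
    and bounded_l: "bounded (range l)"
begin

section \<open>Consequences of the parameter condition\<close>

lemma L_nonneg: "0 \<le> L"
  using lip by (rule lipschitz_on_nonneg)

text \<open>The first fraction of \<open>descent_condition\<close> is nonnegative, so the second one
  must be negative.\<close>

lemma primal_decrease_dominates: "\<gamma>\<^sup>2 * (\<rho> + L) < (1 - \<gamma>)\<^sup>2 * (\<rho> - \<mu>)"
proof -
  have *: "b < c" if "a + (b - c) / 2 < 0" "0 \<le> a" for a b c :: real
    using that by argo
  show ?thesis by (rule *[OF descent_condition]) (use \<rho> in simp)
qed

text \<open>Guarantees that \<open>(1 - \<gamma>) * \<Delta> r\<close> is nonnegative, so that the
  lower bound on the distance from \<open>x r\<close> to \<open>xs r\<close> can be squared in
  \<open>x_step\<close>.\<close>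

lemma gamma_less_1: "\<gamma> < 1"
proof (rule ccontr)
  assume "\<not> \<gamma> < 1"
  then have "(1 - \<gamma>)\<^sup>2 \<le> \<gamma>\<^sup>2" by (simp add: power2_eq_square algebra_simps)
  then have "(1 - \<gamma>)\<^sup>2 * (\<rho> - \<mu>) \<le> (1 - \<gamma>)\<^sup>2 * \<rho>" and "(1 - \<gamma>)\<^sup>2 * \<rho> \<le> \<gamma>\<^sup>2 * \<rho>"
    using \<mu> \<rho> by (auto intro: mult_left_mono mult_right_mono)
  moreover have "\<gamma>\<^sup>2 * \<rho> \<le> \<gamma>\<^sup>2 * (\<rho> + L)" using L_nonneg by (simp add: mult_left_mono)
  ultimately show False using primal_decrease_dominates by simp
qed

lemma sigma_pos: "0 < \<rho> - \<mu>"
proof -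
  have "0 \<le> \<gamma>\<^sup>2 * (\<rho> + L)" using L_nonneg \<rho> by simp
  then have "0 < (1 - \<gamma>)\<^sup>2 * (\<rho> - \<mu>)" using primal_decrease_dominates by (rule le_less_trans)
  then show ?thesis by (metis zero_less_mult_pos zero_le_power2 not_less mult_nonneg_nonpos)
qed

section \<open>Smoothness and convexity of the augmented Lagrangian in its first argument\<close>

lemma gderiv_lagr: "GDERIV (\<lambda>u. lagr u v w) z :> g z + w + \<rho> *\<^sub>R (z - v)"
proof -
  have "(f has_derivative (\<lambda>h. h \<bullet> g z)) (at z)" using grad unfolding gderiv_def .
  then show ?thesis
    unfolding gderiv_def lagr_def power2_norm_eq_inner
    by (auto intro!: derivative_eq_intros simp: algebra_simps inner_commute)
qed

text \<open>The penalty differs from \<open>\<rho> / 2 * (norm u)\<^sup>2\<close> only by an affine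
  function of \<open>u\<close>; after subtracting
  \<open>(\<rho> - \<mu>) / 2 * (norm u)\<^sup>2\<close>, exactly the term that makes
  \<open>f\<close> convex is left.\<close>

lemma convex_lagr: "convex_on UNIV (\<lambda>u. lagr u v w - (\<rho> - \<mu>) / 2 * (norm u)\<^sup>2)"
proof -
  have "convex_on UNIV (\<lambda>u. c \<bullet> u + k)" for c :: 'a and k
    by (rule convex_onI) (auto simp: inner_add_right inner_diff_right algebra_simps)
  then have "convex_on UNIV (\<lambda>u. (f u + \<mu> / 2 * (norm u)\<^sup>2)
      + ((w - \<rho> *\<^sub>R v) \<bullet> u + (\<rho> / 2 * (norm v)\<^sup>2 - w \<bullet> v)))"
    by (rule convex_on_add[OF weakly_convex])
  moreover have "lagr u v w - (\<rho> - \<mu>) / 2 * (norm u)\<^sup>2 = (f u + \<mu> / 2 * (norm u)\<^sup>2)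
      + ((w - \<rho> *\<^sub>R v) \<bullet> u + (\<rho> / 2 * (norm v)\<^sup>2 - w \<bullet> v))" for u
    unfolding lagr_def power2_norm_eq_inner
    by (simp add: field_simps inner_commute[of v u] inner_diff_left inner_diff_right)
  ultimately show ?thesis by simp
qed

lemma gradient_lagr_lipschitz: "(\<rho> + L)-lipschitz_on UNIV (\<lambda>z. g z + w + \<rho> *\<^sub>R (z - v))"
proof (rule lipschitz_onI)
  fix a b :: 'a
  have "norm (g a + w + \<rho> *\<^sub>R (a - v) - (g b + w + \<rho> *\<^sub>R (b - v)))
      = norm ((g a - g b) + \<rho> *\<^sub>R (a - b))" by (simp add: algebra_simps)
  also have "\<dots> \<le> norm (g a - g b) + \<rho> * norm (a - b)"
    using norm_triangle_ineq[of "g a - g b" "\<rho> *\<^sub>R (a - b)"] \<rho> by simp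
  also have "\<dots> \<le> L * norm (a - b) + \<rho> * norm (a - b)"
    using lipschitz_onD[OF lip, of a b] by (simp add: dist_norm)
  finally show "dist (g a + w + \<rho> *\<^sub>R (a - v)) (g b + w + \<rho> *\<^sub>R (b - v)) \<le> (\<rho> + L) * dist a b"
    by (simp add: dist_norm algebra_simps)
qed (use L_nonneg \<rho> in simp)

section \<open>Estimates for a single iteration\<close>

definition \<Delta> :: "nat \<Rightarrow> real" where "\<Delta> r = norm (x (Suc r) - x r)"

lemma Delta_nonneg: "0 \<le> \<Delta> r"
  by (simp add: \<Delta>_def)

lemma first_order: "g (xs r) + l r + \<rho> *\<^sub>R (xs r - y (Suc r)) = 0"
  by (rule gderiv_zero_at_min[of "\<lambda>u. lagr u (y (Suc r)) (l r)", OF gderiv_lagr xs_min])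

text \<open>By the dual update, the left-hand vector is the gradient of the
  \<open>x\<close>-subproblem at \<open>x (Suc r)\<close>. That gradient vanishes at
  \<open>xs r\<close>, so its size is controlled by the inexactness.\<close>

lemma l_plus_gradient: "norm (l (Suc r) + g (x (Suc r))) \<le> (\<rho> + L) * (\<gamma> * \<Delta> r)"
proof -
  let ?G = "\<lambda>z. g z + l r + \<rho> *\<^sub>R (z - y (Suc r))"
  have "l (Suc r) + g (x (Suc r)) = ?G (x (Suc r)) - ?G (xs r)"
    by (simp add: l_Suc first_order)
  also have "norm \<dots> \<le> (\<rho> + L) * norm (x (Suc r) - xs r)"
    using lipschitz_onD[OF gradient_lagr_lipschitz, of "x (Suc r)" "xs r"] by (simp add: dist_norm)
  also have "\<dots> \<le> (\<rho> + L) * (\<gamma> * \<Delta> r)"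
    using error L_nonneg \<rho> by (intro mult_left_mono) (auto simp: \<Delta>_def)
  finally show ?thesis .
qed

text \<open>Both values are compared with the exact minimum at \<open>xs r\<close>: smoothness
  limits the excess at \<open>x (Suc r)\<close>, while strong convexity makes the value at
  \<open>x r\<close> larger by a quadratic amount.\<close>

lemma x_step:
  "lagr (x (Suc r)) (y (Suc r)) (l r)
    \<le> lagr (x r) (y (Suc r)) (l r) + (\<gamma>\<^sup>2 * (\<rho> + L) - (1 - \<gamma>)\<^sup>2 * (\<rho> - \<mu>)) / 2 * (\<Delta> r)\<^sup>2"
proof -
  let ?h = "\<lambda>u. lagr u (y (Suc r)) (l r)"
  have "?h (xs r + (x (Suc r) - xs r)) \<le> ?h (xs r) + 0 \<bullet> (x (Suc r) - xs r)
      + (\<rho> + L) / 2 * (norm (x (Suc r) - xs r))\<^sup>2"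
    using gderiv_lipschitz_upper_bound[OF gderiv_lagr gradient_lagr_lipschitz] first_order by metis
  moreover have "(norm (x (Suc r) - xs r))\<^sup>2 \<le> \<gamma>\<^sup>2 * (\<Delta> r)\<^sup>2"
    using power_mono[OF error, of r 2] by (simp add: \<Delta>_def power_mult_distrib)
  then have "(\<rho> + L) / 2 * (norm (x (Suc r) - xs r))\<^sup>2 \<le> (\<rho> + L) / 2 * (\<gamma>\<^sup>2 * (\<Delta> r)\<^sup>2)"
    using L_nonneg \<rho> by (intro mult_left_mono) auto
  moreover have "?h (xs r) + (\<rho> - \<mu>) / 2 * (norm (x r - xs r))\<^sup>2 \<le> ?h (x r)"
    using convex_lagr xs_min by (rule strongly_convex_min_growth)
  \<comment> \<open>The error is at most \<open>\<gamma> * \<Delta> r\<close>, so the triangle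
    inequality leaves at least \<open>(1 - \<gamma>) * \<Delta> r\<close> for the exact
    step.\<close>
  moreover have "(1 - \<gamma>) * \<Delta> r \<le> norm (x r - xs r)"
    using norm_triangle_ineq4[of "x (Suc r) - xs r" "x r - xs r"] error[of r]
    by (simp add: \<Delta>_def algebra_simps)
  then have "(1 - \<gamma>)\<^sup>2 * (\<Delta> r)\<^sup>2 \<le> (norm (x r - xs r))\<^sup>2"
    using gamma_less_1 Delta_nonneg[of r] by (metis power_mono power_mult_distrib
      diff_ge_0_iff_ge less_imp_le mult_nonneg_nonneg)
  then have "(\<rho> - \<mu>) / 2 * ((1 - \<gamma>)\<^sup>2 * (\<Delta> r)\<^sup>2) \<le> (\<rho> - \<mu>) / 2 * (norm (x r - xs r))\<^sup>2"
    using sigma_pos by (intro mult_left_mono) auto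
  ultimately show ?thesis by (simp add: field_simps)
qed

lemma y_step: "lagr (x r) (y (Suc r)) (l r) \<le> lagr (x r) (y r) (l r)"
proof -
  \<comment> \<open>Completing the square shows that minimising over \<open>v\<close> is the
    projection problem; \<open>y r\<close> is then an admissible competitor.\<close>
  have complete: "lagr (x r) v (l r)
      = f (x r) + \<rho> / 2 * (norm (x r + (1 / \<rho>) *\<^sub>R l r - v))\<^sup>2 - (norm (l r))\<^sup>2 / (2 * \<rho>)" for v
  proof -
    have "x r + (1 / \<rho>) *\<^sub>R l r - v = (x r - v) + (1 / \<rho>) *\<^sub>R l r" by simp
    then show ?thesis
      using \<rho> unfolding lagr_def
      by (simp only: norm_add_scaled_squared) (simp add: field_simps power2_eq_square)
  qed
  show ?thesis
    unfolding complete using power_mono[OF y_min[OF y_in[of r]], of r 2] \<rho> by simp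
qed

text \<open>Each multiplier is replaced by minus the gradient at its iterate, at the cost of
  \<open>l_plus_gradient\<close>. The indices start at \<open>Suc r\<close> because the arbitrary
  \<open>l 0\<close> has no relation to a gradient.\<close>

lemma l_difference:
  "norm (l (Suc (Suc r)) - l (Suc r))
    \<le> L * \<Delta> (Suc r) + (\<rho> + L) * \<gamma> * (\<Delta> (Suc r) + \<Delta> r)"
proof -
  have "norm (l (Suc (Suc r)) - l (Suc r))
      = norm ((l (Suc (Suc r)) + g (x (Suc (Suc r)))) - (l (Suc r) + g (x (Suc r)))
          - (g (x (Suc (Suc r))) - g (x (Suc r))))" by simp
  also have "\<dots> \<le> norm (l (Suc (Suc r)) + g (x (Suc (Suc r)))) + norm (l (Suc r) + g (x (Suc r)))
      + norm (g (x (Suc (Suc r))) - g (x (Suc r)))"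
    by (meson norm_triangle_ineq4 add_right_mono order_trans)
  also have "\<dots> \<le> (\<rho> + L) * (\<gamma> * \<Delta> (Suc r)) + (\<rho> + L) * (\<gamma> * \<Delta> r) + L * \<Delta> (Suc r)"
    using l_plus_gradient lipschitz_onD[OF lip, of "x (Suc (Suc r))" "x (Suc r)"]
    by (intro add_mono) (auto simp: dist_norm \<Delta>_def)
  finally show ?thesis by (simp add: algebra_simps)
qed

lemma l_difference_squared:
  "(norm (l (Suc (Suc r)) - l (Suc r)))\<^sup>2
    \<le> (2 * L\<^sup>2 + 4 * (\<rho> + L)\<^sup>2 * \<gamma>\<^sup>2) * (\<Delta> (Suc r))\<^sup>2 + 4 * (\<rho> + L)\<^sup>2 * \<gamma>\<^sup>2 * (\<Delta> r)\<^sup>2"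
proof -
  have sum_sq: "(a + b)\<^sup>2 \<le> 2 * a\<^sup>2 + 2 * b\<^sup>2" for a b :: real
    using zero_le_power2[of "a - b"] by (simp add: power2_eq_square algebra_simps)
  have "(norm (l (Suc (Suc r)) - l (Suc r)))\<^sup>2
      \<le> (L * \<Delta> (Suc r) + (\<rho> + L) * \<gamma> * (\<Delta> (Suc r) + \<Delta> r))\<^sup>2"
    using l_difference by (intro power_mono) auto
  also have "\<dots> \<le> 2 * (L * \<Delta> (Suc r))\<^sup>2 + 2 * ((\<rho> + L) * \<gamma> * (\<Delta> (Suc r) + \<Delta> r))\<^sup>2"
    by (rule sum_sq)
  also have "((\<rho> + L) * \<gamma> * (\<Delta> (Suc r) + \<Delta> r))\<^sup>2
      \<le> (\<rho> + L)\<^sup>2 * \<gamma>\<^sup>2 * (2 * (\<Delta> (Suc r))\<^sup>2 + 2 * (\<Delta> r)\<^sup>2)"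
    unfolding power_mult_distrib by (intro mult_left_mono sum_sq) simp
  finally show ?thesis by (simp add: power_mult_distrib algebra_simps)
qed

text \<open>The only one of the three updates that raises the Lagrangian;
  \<open>l_difference_squared\<close> bounds the increase.\<close>

lemma l_step:
  "lagr (x (Suc r)) (y (Suc r)) (l (Suc r))
    = lagr (x (Suc r)) (y (Suc r)) (l r) + (norm (l (Suc r) - l r))\<^sup>2 / \<rho>"
proof -
  have "lagr (x (Suc r)) (y (Suc r)) (l (Suc r))
      = lagr (x (Suc r)) (y (Suc r)) (l r) + (l (Suc r) - l r) \<bullet> (x (Suc r) - y (Suc r))"
    by (simp add: lagr_def inner_diff_left)
  also have "(l (Suc r) - l r) \<bullet> (x (Suc r) - y (Suc r)) = \<rho> * (norm (x (Suc r) - y (Suc r)))\<^sup>2"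
    by (simp add: l_Suc dot_square_norm)
  also have "\<dots> = (norm (l (Suc r) - l r))\<^sup>2 / \<rho>"
    using \<rho> by (simp add: l_Suc power_mult_distrib power2_eq_square)
  finally show ?thesis .
qed

section \<open>The Lyapunov function and vanishing steps\<close>

definition \<kappa> :: real where "\<kappa> = 4 * (\<rho> + L)\<^sup>2 * \<gamma>\<^sup>2 / \<rho>"

definition rate :: real where
  "rate = - ((2 * L\<^sup>2 + 8 * (\<rho> + L)\<^sup>2 * \<gamma>\<^sup>2) / \<rho>
           + (\<gamma>\<^sup>2 * (\<rho> + L) - (1 - \<gamma>)\<^sup>2 * (\<rho> - \<mu>)) / 2)"

text \<open>\<open>\<kappa>\<close> is the coefficient of \<open>(\<Delta> r)\<^sup>2\<close> in the
  bound on the dual increase, so the added term pays in advance for the older step in the next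
  iteration.\<close>

definition lyapunov :: "nat \<Rightarrow> real" where
  "lyapunov r = lagr (x (Suc r)) (y (Suc r)) (l (Suc r)) + \<kappa> * (\<Delta> r)\<^sup>2"

lemma lyapunov_decrease: "rate * (\<Delta> (Suc r))\<^sup>2 \<le> lyapunov r - lyapunov (Suc r)"
proof -
  have "(norm (l (Suc (Suc r)) - l (Suc r)))\<^sup>2 / \<rho>
      \<le> ((2 * L\<^sup>2 + 4 * (\<rho> + L)\<^sup>2 * \<gamma>\<^sup>2) * (\<Delta> (Suc r))\<^sup>2
          + 4 * (\<rho> + L)\<^sup>2 * \<gamma>\<^sup>2 * (\<Delta> r)\<^sup>2) / \<rho>"
    using l_difference_squared \<rho> by (intro divide_right_mono) auto
  \<comment> \<open>The 4 becomes an 8 minus \<open>\<kappa>\<close>: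
    \<open>lyapunov (Suc r)\<close> itself contains
    \<open>\<kappa> * (\<Delta> (Suc r))\<^sup>2\<close>, which accounts for the 8 in the parameter
    condition.\<close>
  also have "\<dots> = ((2 * L\<^sup>2 + 8 * (\<rho> + L)\<^sup>2 * \<gamma>\<^sup>2) / \<rho> - \<kappa>) * (\<Delta> (Suc r))\<^sup>2 + \<kappa> * (\<Delta> r)\<^sup>2"
    using \<rho> by (simp add: \<kappa>_def field_simps)
  finally show ?thesis
    using x_step[of "Suc r"] y_step[of "Suc r"] l_step[of "Suc r"]
    unfolding lyapunov_def rate_def by (simp add: algebra_simps)
qed

text \<open>\<open>f\<close> is bounded on the compact closure of the iterates, Cauchy-Schwarz
  bounds the multiplier term, and the penalty is nonnegative.\<close>

lemma lagr_bounded_below: "\<exists>m. \<forall>r. m \<le> lagr (x r) (y r) (l r)"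
proof -
  have "isCont f z" for z
    using grad[of z] unfolding gderiv_def by (rule has_derivative_continuous)
  then have "continuous_on UNIV f"
    by (simp add: continuous_at_imp_continuous_on)
  then have "compact (f ` closure (range x))"
    by (intro compact_continuous_image) (auto simp: bounded_x intro: continuous_on_subset)
  then obtain B where "\<And>z. z \<in> closure (range x) \<Longrightarrow> \<bar>f z\<bar> \<le> B"
    using compact_imp_bounded[of "f ` closure (range x)"] by (auto simp: bounded_iff)
  then have f_bound: "\<bar>f (x r)\<bar> \<le> B" for r
    using closure_subset[of "range x"] by auto
  obtain X where X: "norm (x r) \<le> X" for r using bounded_x unfolding bounded_iff by auto
  obtain Y where Y: "norm (y r) \<le> Y" for r using bounded_y unfolding bounded_iff by auto
  obtain W where W: "norm (l r) \<le> W" for r using bounded_l unfolding bounded_iff by auto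
  have "- B - W * (X + Y) \<le> lagr (x r) (y r) (l r)" for r
  proof -
    have "\<bar>l r \<bullet> (x r - y r)\<bar> \<le> norm (l r) * norm (x r - y r)"
      by (rule Cauchy_Schwarz_ineq2)
    also have "\<dots> \<le> W * (X + Y)"
      using W[of r] X[of r] Y[of r] norm_triangle_ineq4[of "x r" "y r"]
        order_trans[OF norm_ge_zero W] by (intro mult_mono) auto
    moreover have "0 \<le> \<rho> / 2 * (norm (x r - y r))\<^sup>2" using \<rho> by simp
    ultimately show ?thesis using f_bound[of r] unfolding lagr_def by linarith
  qed
  then show ?thesis by blast
qed

text \<open>A decreasing sequence bounded below converges, so the drops of \<open>lyapunov\<close>
  tend to 0, and they dominate the squared steps.\<close>

lemma Delta_tendsto_0: "\<Delta> \<longlonglongrightarrow> 0"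
proof -
  have rate: "0 < rate" using descent_condition unfolding rate_def by (simp only: neg_0_less_iff_less)
  obtain m where m: "m \<le> lagr (x r) (y r) (l r)" for r using lagr_bounded_below by blast
  have "0 \<le> \<kappa>" using \<rho> by (simp add: \<kappa>_def)
  then have lower: "m \<le> lyapunov r" for r
    unfolding lyapunov_def using m[of "Suc r"] by (simp add: add_increasing2)
  have "decseq lyapunov"
  proof (rule decseq_SucI)
    show "lyapunov (Suc r) \<le> lyapunov r" for r
      using order_trans[OF mult_nonneg_nonneg[OF less_imp_le[OF rate] zero_le_power2] lyapunov_decrease]
      by simp
  qed
  then obtain c where "lyapunov \<longlonglongrightarrow> c" using decseq_convergent[of lyapunov m] lower by blast
  then have "(\<lambda>r. (lyapunov r - lyapunov (Suc r)) / rate) \<longlonglongrightarrow> (c - c) / rate"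
    by (intro tendsto_intros LIMSEQ_Suc) (use rate in auto)
  then have lim: "(\<lambda>r. (lyapunov r - lyapunov (Suc r)) / rate) \<longlonglongrightarrow> 0" by simp
  have "(\<Delta> (Suc r))\<^sup>2 \<le> (lyapunov r - lyapunov (Suc r)) / rate" for r
    using lyapunov_decrease[of r] rate by (simp add: pos_le_divide_eq mult.commute)
  then have "(\<lambda>r. (\<Delta> (Suc r))\<^sup>2) \<longlonglongrightarrow> 0"
    by (intro tendsto_sandwich[OF _ _ tendsto_const lim]) auto
  then have "(\<lambda>r. sqrt ((\<Delta> (Suc r))\<^sup>2)) \<longlonglongrightarrow> sqrt 0" by (rule tendsto_real_sqrt)
  then have "(\<lambda>r. \<Delta> (Suc r)) \<longlonglongrightarrow> 0" by (simp add: Delta_nonneg)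
  then show ?thesis by (rule LIMSEQ_imp_Suc)
qed

section \<open>Asymptotic feasibility and stationarity of limit points\<close>

lemma x_minus_y_tendsto_0: "(\<lambda>r. x r - y r) \<longlonglongrightarrow> 0"
proof -
  have "(\<lambda>r. L * \<Delta> (Suc r) + (\<rho> + L) * \<gamma> * (\<Delta> (Suc r) + \<Delta> r))
      \<longlonglongrightarrow> L * 0 + (\<rho> + L) * \<gamma> * (0 + 0)"
    by (intro tendsto_intros LIMSEQ_Suc Delta_tendsto_0)
  then have "(\<lambda>r. l (Suc (Suc r)) - l (Suc r)) \<longlonglongrightarrow> 0"
    by (intro Lim_null_comparison[OF always_eventually[rule_format, OF l_difference]]) simp
  then have "(\<lambda>r. (1 / \<rho>) *\<^sub>R (l (Suc (Suc r)) - l (Suc r))) \<longlonglongrightarrow> (1 / \<rho>) *\<^sub>R 0"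
    by (intro tendsto_intros)
  \<comment> \<open>The dual update read backwards: the primal gap is the multiplier difference
    divided by \<open>\<rho>\<close>.\<close>
  then have "(\<lambda>r. x (Suc (Suc r)) - y (Suc (Suc r))) \<longlonglongrightarrow> 0"
    using \<rho> by (simp add: l_Suc[of "Suc _"])
  then have "(\<lambda>r. x (Suc r) - y (Suc r)) \<longlonglongrightarrow> 0" by (rule LIMSEQ_imp_Suc)
  then show ?thesis by (rule LIMSEQ_imp_Suc)
qed

lemma l_plus_gradient_tendsto_0: "(\<lambda>r. l r + g (x r)) \<longlonglongrightarrow> 0"
proof -
  have "(\<lambda>r. (\<rho> + L) * (\<gamma> * \<Delta> r)) \<longlonglongrightarrow> (\<rho> + L) * (\<gamma> * 0)"
    by (intro tendsto_intros Delta_tendsto_0)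
  then have "(\<lambda>r. l (Suc r) + g (x (Suc r))) \<longlonglongrightarrow> 0"
    by (intro Lim_null_comparison[OF always_eventually[rule_format, OF l_plus_gradient]]) simp
  then show ?thesis by (rule LIMSEQ_imp_Suc)
qed

text \<open>The \<open>y\<close>-step at time \<open>s k\<close> compares
  \<open>y (Suc (s k))\<close> with every point of \<open>A\<close>. Both it and
  \<open>x (s k)\<close> tend to \<open>xbar\<close>, and \<open>l (s k)\<close> tends to
  \<open>- g xbar\<close>, so the inequality survives in the limit.\<close>

lemma limit_point_stationary:
  assumes s: "strict_mono s" and lim: "(\<lambda>k. x (s k)) \<longlonglongrightarrow> xbar" and "closed A"
  shows "xbar \<in> A"
    and "a \<in> A \<Longrightarrow> norm (xbar - (xbar - (1 / \<rho>) *\<^sub>R g xbar)) \<le> norm (a - (xbar - (1 / \<rho>) *\<^sub>R g xbar))"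
proof -
  note subseq = LIMSEQ_subseq_LIMSEQ[OF _ s, unfolded comp_def]
  have "(\<lambda>k. x (Suc (s k)) - x (s k)) \<longlonglongrightarrow> 0"
    using subseq[OF Delta_tendsto_0] unfolding \<Delta>_def by (rule tendsto_norm_zero_cancel)
  \<comment> \<open>This sum telescopes to \<open>y (Suc (s k))\<close>, bridging the index shift
    between the subsequence and the projection.\<close>
  then have "(\<lambda>k. x (s k) + (x (Suc (s k)) - x (s k)) - (x (Suc (s k)) - y (Suc (s k))))
      \<longlonglongrightarrow> xbar + 0 - 0"
    by (intro tendsto_intros lim subseq[OF LIMSEQ_Suc[OF x_minus_y_tendsto_0]])
  then have y_lim: "(\<lambda>k. y (Suc (s k))) \<longlonglongrightarrow> xbar" by simp
  then show "xbar \<in> A"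
    using \<open>closed A\<close> y_in closed_sequentially by metis
  have "isCont g xbar"
    using lipschitz_on_continuous_on[OF lip] by (simp add: continuous_on_eq_continuous_at)
  then have "(\<lambda>k. g (x (s k))) \<longlonglongrightarrow> g xbar" using lim by (rule isCont_tendsto_compose)
  then have "(\<lambda>k. (l (s k) + g (x (s k))) - g (x (s k))) \<longlonglongrightarrow> 0 - g xbar"
    by (intro tendsto_diff subseq[OF l_plus_gradient_tendsto_0])
  then have "(\<lambda>k. l (s k)) \<longlonglongrightarrow> - g xbar" by simp
  then have p_lim: "(\<lambda>k. x (s k) + (1 / \<rho>) *\<^sub>R l (s k)) \<longlonglongrightarrow> xbar + (1 / \<rho>) *\<^sub>R (- g xbar)"
    by (intro tendsto_intros lim)
  show "norm (xbar - (xbar - (1 / \<rho>) *\<^sub>R g xbar)) \<le> norm (a - (xbar - (1 / \<rho>) *\<^sub>R g xbar))"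
    if "a \<in> A"
  proof -
    have "norm (xbar + (1 / \<rho>) *\<^sub>R (- g xbar) - xbar) \<le> norm (xbar + (1 / \<rho>) *\<^sub>R (- g xbar) - a)"
    proof (rule LIMSEQ_le)
      show "(\<lambda>k. norm (x (s k) + (1 / \<rho>) *\<^sub>R l (s k) - y (Suc (s k))))
          \<longlonglongrightarrow> norm (xbar + (1 / \<rho>) *\<^sub>R (- g xbar) - xbar)"
        by (intro tendsto_norm tendsto_diff p_lim y_lim)
      show "(\<lambda>k. norm (x (s k) + (1 / \<rho>) *\<^sub>R l (s k) - a))
          \<longlonglongrightarrow> norm (xbar + (1 / \<rho>) *\<^sub>R (- g xbar) - a)"
        by (intro tendsto_norm tendsto_diff p_lim tendsto_const)
    qed (use y_min[OF that] in blast)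
    then show ?thesis by (simp add: norm_minus_commute)
  qed
qed

end

section \<open>From the algorithm to the abstract run\<close>

theorem theorem4p1:
  fixes A :: "(real ^ 'n::{finite,linorder}) set"
    and f :: "real ^ 'n::{finite,linorder} \<Rightarrow> real"
    and L_f \<mu> \<rho> \<gamma> :: real
    and x y l :: "nat \<Rightarrow> real ^ 'n::{finite,linorder}"
    and xbar ybar lbar :: "real ^ 'n::{finite,linorder}"
  assumes "finite A" and "A \<noteq> {}"
    and "- \<infinity> < (MIN a\<in>A. ereal (f a))"
    and "\<forall>z. f differentiable (at z)"
    and "L_f-lipschitz_on UNIV (gradient f)"
    and "\<mu> \<ge> 0" and "convex_on UNIV (\<lambda>z. f z + \<mu> / 2 * (norm z)\<^sup>2)"
    and "\<rho> > 0" and "\<gamma> > 0"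
    and "(2 * L_f\<^sup>2 + 8 * (\<rho> + L_f)\<^sup>2 * \<gamma>\<^sup>2) / \<rho>
           + (\<gamma>\<^sup>2 * (\<rho> + L_f) - (1 - \<gamma>)\<^sup>2 * (\<rho> - \<mu>)) / 2 < 0"
    and "I_ADMM_Q f A \<rho> \<gamma> x y l"
    and "bounded (range (\<lambda>r. (x r, y r, l r)))"
    and "seq_limit_point (\<lambda>r. (x r, y r, l r)) (xbar, ybar, lbar)"
  shows "rho_stationary f A \<rho> xbar"
proof -
  note run = \<open>I_ADMM_Q f A \<rho> \<gamma> x y l\<close>[unfolded I_ADMM_Q_def]
  have y_Suc: "y (Suc r) = projection A (x r + (1 / \<rho>) *\<^sub>R l r)" for r using run by blast
  note proj = projection_works(1)[OF \<open>finite A\<close> \<open>A \<noteq> {}\<close>, unfolded is_arg_min_linorder]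
  have y_in: "y r \<in> A" for r
    by (cases r) (use run proj y_Suc in auto)
  have "\<forall>r. \<exists>z. is_arg_min (\<lambda>z. aug_lagrangian f A \<rho> z (y (Suc r)) (l r)) (\<lambda>z. True) z \<and>
             norm (x (Suc r) - z)
               \<le> \<gamma> * min (norm (x (Suc r) - y (Suc r))) (norm (x (Suc r) - x r))"
    using run by blast
  then obtain xs where
      xs_arg_min: "is_arg_min (\<lambda>z. aug_lagrangian f A \<rho> z (y (Suc r)) (l r)) (\<lambda>z. True) (xs r)"
    and xs_error: "norm (x (Suc r) - xs r)
               \<le> \<gamma> * min (norm (x (Suc r) - y (Suc r))) (norm (x (Suc r) - x r))" for r
    by metis
  interpret inexact_admm_run f "gradient f" A L_f \<mu> \<rho> \<gamma> x y l xs
    "\<lambda>u v w. f u + w \<bullet> (u - v) + \<rho> / 2 * (norm (u - v))\<^sup>2"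
  proof unfold_locales
    show "GDERIV f z :> gradient f z" for z
      using assms(4) by (simp add: gderiv_gradient)
    show "norm (x r + (1 / \<rho>) *\<^sub>R l r - y (Suc r)) \<le> norm (x r + (1 / \<rho>) *\<^sub>R l r - a)"
      if "a \<in> A" for a r
      using proj that unfolding y_Suc by (simp add: power2_le_iff_abs_le)
    \<comment> \<open>Since \<open>y (Suc r)\<close> lies in \<open>A\<close>, the indicator is 0 on
      both sides and the extended-real minimality becomes a real inequality.\<close>
    show "f (xs r) + l r \<bullet> (xs r - y (Suc r)) + \<rho> / 2 * (norm (xs r - y (Suc r)))\<^sup>2
        \<le> f z + l r \<bullet> (z - y (Suc r)) + \<rho> / 2 * (norm (z - y (Suc r)))\<^sup>2" for r z
      using xs_arg_min[of r] y_in
      by (simp add: is_arg_min_linorder aug_lagrangian_def indicator_inf_def)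
    show "norm (x (Suc r) - xs r) \<le> \<gamma> * norm (x (Suc r) - x r)" for r
      using xs_error[of r] \<open>\<gamma> > 0\<close> by (meson min.cobounded2 mult_left_mono less_imp_le order_trans)
    show "l (Suc r) = l r + \<rho> *\<^sub>R (x (Suc r) - y (Suc r))" for r
      using run by blast
    note B = \<open>bounded (range (\<lambda>r. (x r, y r, l r)))\<close>
    show "bounded (range x)" using bounded_fst[OF B] by (simp add: image_image)
    show "bounded (range y)" using bounded_fst[OF bounded_snd[OF B]] by (simp add: image_image)
    show "bounded (range l)" using bounded_snd[OF bounded_snd[OF B]] by (simp add: image_image)
  qed (use assms y_in in auto)
  obtain s where "strict_mono s" and "((\<lambda>r. (x r, y r, l r)) \<circ> s) \<longlonglongrightarrow> (xbar, ybar, lbar)"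
    using assms(13) unfolding seq_limit_point_def by blast
  then have s: "strict_mono s" "(\<lambda>k. x (s k)) \<longlonglongrightarrow> xbar"
    using tendsto_fst[of "(\<lambda>r. (x r, y r, l r)) \<circ> s"] by (auto simp: comp_def)
  show ?thesis
    unfolding rho_stationary_def is_arg_min_linorder
    using limit_point_stationary[OF s finite_imp_closed[OF \<open>finite A\<close>]] by blast
qed

end
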